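(* Let $\alpha>1$ and consider the power-law family $f_a(x)=-|x|^{\alpha}+a$, $a\in\mathbb{R}$. There exists a unique parameter $a=a(\alpha)$ for which the kneading sequence of $f_a$ is $RLRRRLRC$, i.e. $f_a(0)>0$, $f_a^2(0)<0$, $f_a^3(0)>0$, $f_a^4(0)>0$, $f_a^5(0)>0$, $f_a^6(0)<0$, $f_a^7(0)>0$ and $f_a^8(0)=0$.
   Context: The kneading sequence lists, for $n=1,2,\dots$, the symbol $R$, $L$ or $C$ according as $f_a^n(0)>0$, $<0$ or $=0$, terminating at the first $C$. The sequence $RLRRRLRC$ corresponds to a super-attracting periodic orbit of period $8$. *)

theory Defs
  imports Complex_Main
begin

definition powf :: "real \<Rightarrow> real \<Rightarrow> real \<Rightarrow> real" where
  "powf alpha a x = - (\<bar>x\<bar> powr alpha) + a"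

datatype kn_symbol = R | L | C

definition kn_sym :: "real \<Rightarrow> kn_symbol" where
  "kn_sym x = (if x > 0 then R else if x < 0 then L else C)"

definition has_kneading :: "(real \<Rightarrow> real) \<Rightarrow> kn_symbol list \<Rightarrow> bool" where
  "has_kneading f w \<longleftrightarrow>
     w \<noteq> [] \<and> last w = C \<and> C \<notin> set (butlast w) \<and>
     (\<forall>n < length w. kn_sym ((f ^^ (Suc n)) 0) = w ! n)"

end

theory Submission
  imports Defs "HOL-Analysis.Analysis"
begin

text \<open>Put \<open>b = 1 / \<alpha>\<close>, \<open>u = a\<^bsup>b-1\<^esup>\<close> and \<open>x\<^sub>k = f\<^sub>a\<^bsup>k\<^esup>(0) / a\<close>. The prescribed signs let one solve the orbit
  backwards from \<open>x\<^sub>8 = 0\<close> by \<open>\<bar>x\<^sub>k\<bar> = u (1 - x\<^sub>k\<^sub>+\<^sub>1)\<^bsup>b\<^esup>\<close>, so everything becomes a function of \<open>u \<in> (0,1)\<close>, and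
  the kneading condition becomes \<open>x\<^sub>5 < 1\<close> and \<open>x\<^sub>1 = 1\<close>. For uniqueness, \<open>x\<^sub>1\<close> is increasing at each
  solution. The logarithmic derivatives satisfy \<open>e\<^sub>k = 1 - b x\<^sub>k\<^sub>+\<^sub>1 e\<^sub>k\<^sub>+\<^sub>1 / (1 - x\<^sub>k\<^sub>+\<^sub>1)\<close>, and two features
  of the period doubling structure give \<open>e\<^sub>1 > 0\<close>: the pair \<open>x\<^sub>2, x\<^sub>3\<close> contributes at most as much
  as its neighbour \<open>x\<^sub>6, x\<^sub>7\<close>, and the product over \<open>x\<^sub>2, x\<^sub>3, x\<^sub>4, x\<^sub>5\<close> is at most 1, by following
  the interval \<open>[x\<^sub>5, x\<^sub>1]\<close> for three steps with the concavity of the \<open>b\<close>-th power.\<close>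

section \<open>Crossing a level only upwards\<close>

text \<open>Otherwise take the last point with \<open>f\<close> at least \<open>c\<close>.
  Continuity makes the value there exactly \<open>c\<close>, and the positive derivative puts
  \<open>f\<close> above \<open>c\<close> just to its right, a contradiction.\<close>

lemma less_level_downward:
  fixes f :: "real \<Rightarrow> real"
  assumes "a \<le> b" and cont: "continuous_on {a..b} f" and "f b < c"
    and up: "\<And>x. a \<le> x \<Longrightarrow> x \<le> b \<Longrightarrow> f x = c \<Longrightarrow> \<exists>D>0. (f has_real_derivative D) (at x)"
  shows "f a < c"
proof (rule ccontr)
  assume "\<not> f a < c"
  define S where "S = {a..b} \<inter> f -` {c..}"
  have "closed S"
    unfolding S_def by (rule continuous_closed_preimage[OF cont]) auto
  moreover have "bdd_above S" "a \<in> S"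
    using assms(1) \<open>\<not> f a < c\<close> unfolding S_def by auto
  ultimately have "Sup S \<in> S"
    using closed_contains_Sup by blast
  define s where "s = Sup S"
  have s: "a \<le> s" "s \<le> b" "c \<le> f s"
    using \<open>Sup S \<in> S\<close> unfolding S_def s_def by auto
  have "s < b"
    using s \<open>f b < c\<close> by (metis less_eq_real_def linorder_not_less)
  have above: "f x < c" if "s < x" "x \<le> b" for x
  proof (rule ccontr)
    assume "\<not> f x < c"
    then have "x \<in> S" using that s by (auto simp: S_def)
    then have "x \<le> s" unfolding s_def using \<open>bdd_above S\<close> by (rule cSup_upper)
    with that show False by simp
  qed
  have "f s = c"
  proof (rule ccontr)
    assume "f s \<noteq> c"
    with s have "c < f s" by simp
    have "continuous_on {s..b} f"
      using cont s by (auto intro: continuous_on_subset)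
    then obtain y where y: "s \<le> y" "y \<le> b" "f y = c"
      using IVT2'[of f b c s] \<open>f b < c\<close> \<open>c < f s\<close> \<open>s < b\<close> by auto
    with \<open>f s \<noteq> c\<close> above[of y] show False by (cases "s = y") auto
  qed
  then obtain D where "D > 0" "(f has_real_derivative D) (at s)"
    using up s by blast
  then obtain d where d: "d > 0" "\<forall>h>0. h < d \<longrightarrow> f s < f (s + h)"
    using DERIV_pos_inc_right by blast
  define h where "h = min (d/2) (b - s)"
  have "h > 0" "h < d" "s + h \<le> b" using d \<open>s < b\<close> by (auto simp: h_def)
  then show False using d \<open>f s = c\<close> above[of "s + h"] by force
qed

section \<open>Inverse branches and the backward orbit\<close>

text \<open>The solution \<open>\<bar>y\<bar> / a\<close> of \<open>f\<^sub>a y = a x\<close>.\<close>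

definition br :: "real \<Rightarrow> real \<Rightarrow> real \<Rightarrow> real" where
  "br b u x = u * (1 - x) powr b"

definition x6 where "x6 b u = - br b u u"
definition x5 where "x5 b u = br b u (x6 b u)"
definition x4 where "x4 b u = br b u (x5 b u)"
definition x3 where "x3 b u = br b u (x4 b u)"
definition x2 where "x2 b u = - br b u (x3 b u)"
definition x1 where "x1 b u = br b u (x2 b u)"

lemma br_zero [simp]: "br b u 0 = u"
  by (simp add: br_def)

lemma br_pos: "0 < u \<Longrightarrow> x < 1 \<Longrightarrow> 0 < br b u x"
  by (simp add: br_def)

lemma br_nonneg: "0 < u \<Longrightarrow> 0 \<le> br b u x"
  by (simp add: br_def)

lemma br_mono: "0 < u \<Longrightarrow> 0 < b \<Longrightarrow> x \<le> y \<Longrightarrow> y \<le> 1 \<Longrightarrow> br b u y \<le> br b u x"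
  by (simp add: br_def powr_mono2)

lemma br_strict_mono: "0 < u \<Longrightarrow> 0 < b \<Longrightarrow> x < y \<Longrightarrow> y \<le> 1 \<Longrightarrow> br b u y < br b u x"
  by (simp add: br_def powr_less_mono2)

lemma br_le: "0 < u \<Longrightarrow> 0 < b \<Longrightarrow> 0 \<le> x \<Longrightarrow> x \<le> 1 \<Longrightarrow> br b u x \<le> u"
  using br_mono[of u b 0 x] by simp

text \<open>Concavity of the \<open>b\<close>-th power: its tangent at \<open>1 - x\<close> lies
  above the graph. Weighted AM-GM for the ratio \<open>(1 - y) / (1 - x)\<close> gives this.\<close>

lemma br_tangent:
  assumes "0 < u" "0 < b" "b < 1" "x < 1" "y < 1"
  shows "b * br b u x * (y - x) / (1 - x) \<le> br b u x - br b u y"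
proof -
  have "((1 - y) / (1 - x)) powr b * 1 powr (1 - b) \<le> b * ((1 - y) / (1 - x)) + (1 - b) * 1"
    by (rule Youngs_inequality_0) (use assms in auto)
  then have "(1 - y) powr b \<le> (1 - x) powr b * (1 + b * ((1 - y) / (1 - x) - 1))"
    using assms by (simp add: powr_divide field_simps)
  also have "(1 - y) / (1 - x) - 1 = - ((y - x) / (1 - x))"
    using assms by (simp add: field_simps)
  finally have "u * (1 - y) powr b \<le> u * ((1 - x) powr b * (1 + b * - ((y - x) / (1 - x))))"
    using assms by simp
  then show ?thesis by (simp add: br_def algebra_simps)
qed

text \<open>Writing the derivative of \<open>g\<close> as \<open>g u * e / u\<close> makes
  \<open>e\<close> its logarithmic derivative, so the product rule yields the recursion for
  \<open>e\<close>.\<close>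

lemma DERIV_br:
  assumes "0 < u" "g u < 1" "(g has_real_derivative g u * e / u) (at u)"
  shows "((\<lambda>v. br b v (g v)) has_real_derivative
           br b u (g u) * (1 - b * (g u / (1 - g u)) * e) / u) (at u)"
proof -
  have eq: "(1 - g u) powr (b - 1) = (1 - g u) powr b / (1 - g u)"
    using assms by (simp add: powr_diff)
  have "((\<lambda>v. v * (1 - g v) powr b) has_real_derivative
      (1 - g u) powr b + u * (b * (1 - g u) powr (b - 1) * - (g u * e / u))) (at u)"
    using assms by (auto intro!: derivative_eq_intros simp: algebra_simps)
  then show ?thesis
    unfolding br_def eq
    by (rule DERIV_cong) (use assms in \<open>simp add: right_diff_distrib diff_divide_distrib\<close>)
qed

lemma DERIV_neg_br:
  assumes "(g has_real_derivative g u * e / u) (at u)"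
  shows "((\<lambda>v. - g v) has_real_derivative (- g u) * e / u) (at u)"
  using DERIV_minus[OF assms] by simp

text \<open>\<open>u x\<^sub>k' / x\<^sub>k\<close>, where \<open>e\<^sub>7 = 1\<close>.\<close>

definition e5 where
  "e5 b u = 1 - b * (x6 b u / (1 - x6 b u)) * (1 - b * (u / (1 - u)))"
definition e3 where
  "e3 b u = 1 - b * (x4 b u / (1 - x4 b u)) * (1 - b * (x5 b u / (1 - x5 b u)) * e5 b u)"
definition e1 where
  "e1 b u = 1 - b * (x2 b u / (1 - x2 b u)) * (1 - b * (x3 b u / (1 - x3 b u)) * e3 b u)"

section \<open>Order and derivatives along the backward orbit\<close>

locale pullback =
  fixes b u :: real
  assumes b: "0 < b" "b < 1" and u: "0 < u" "u < 1"
begin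

lemma x6: "x6 b u < 0" "- 1 < x6 b u"
proof -
  show "x6 b u < 0" using u br_pos[of u u b] by (simp add: x6_def)
  show "- 1 < x6 b u" using u b br_le[of u b u] by (simp add: x6_def)
qed

lemma x5_gt: "u < x5 b u"
  using br_strict_mono[of u b "x6 b u" 0] x6 u b by (simp add: x5_def)

lemma DERIV_x5: "(x5 b has_real_derivative x5 b u * e5 b u / u) (at u)"
proof -
  have "((\<lambda>v. v) has_real_derivative u * 1 / u) (at u)"
    using u by (auto intro!: derivative_eq_intros)
  from DERIV_br[OF u(1) _ this, of b]
  have "(x6 b has_real_derivative x6 b u * (1 - b * (u / (1 - u))) / u) (at u)"
    unfolding x6_def using u by (auto dest: DERIV_neg_br)
  from DERIV_br[OF u(1) _ this, of b] show ?thesis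
    unfolding x5_def[abs_def] e5_def using x6 by auto
qed

text \<open>With \<open>w\<close> as below, the only negative term of \<open>e5\<close> is
  \<open>- b * w * u / (1 - u)\<close>. The tangent estimate gives
  \<open>w * x5 b u \<le> x5 b u - u \<le> 1 - u\<close>, and \<open>u < x5 b u\<close> then bounds
  the term by \<open>b\<close> in size.\<close>

lemma e5_pos:
  assumes "x5 b u \<le> 1"
  shows "0 < e5 b u"
proof -
  define w where "w = b * (- x6 b u / (1 - x6 b u))"
  have "0 < w" unfolding w_def using b x6 by (intro mult_pos_pos divide_pos_pos) auto
  have "w * x5 b u \<le> x5 b u - u"
    using br_tangent[of u b "x6 b u" 0] u b x6 by (simp add: w_def x5_def ac_simps)
  moreover have "w * u \<le> w * x5 b u"
    using \<open>0 < w\<close> x5_gt by simp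
  ultimately have "w * u \<le> 1 - u" using assms by simp
  then have "w * (u / (1 - u)) \<le> 1" using u by (simp add: field_simps)
  then have "b * (w * (u / (1 - u))) \<le> b" using b by (intro mult_left_le) auto
  then have "0 < 1 + w - b * (w * (u / (1 - u)))" using b \<open>0 < w\<close> by linarith
  also have "\<dots> = e5 b u" by (simp add: e5_def w_def right_diff_distrib)
  finally show ?thesis .
qed

end

text \<open>This condition does not follow from \<open>u < 1\<close>; once it holds, the remaining
  arguments of \<open>br\<close> stay below 1.\<close>

locale pullback1 = pullback +
  assumes x5_less: "x5 b u < 1"
begin

lemma x4: "0 < x4 b u" "x4 b u < br b u u" "x4 b u < 1"
proof -
  show "0 < x4 b u" using u x5_less by (simp add: x4_def br_pos)
  show "x4 b u < br b u u"
    using br_strict_mono[of u b u "x5 b u"] u b x5_gt x5_less by (simp add: x4_def)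
  then show "x4 b u < 1" using br_le[of u b u] u b by simp
qed

lemma x3: "0 < x3 b u" "x3 b u < u"
  using br_pos[of u "x4 b u" b] br_strict_mono[of u b 0 "x4 b u"] x4 u b by (auto simp: x3_def)

lemma x2: "x2 b u < x6 b u" "- 1 < x2 b u"
proof -
  show "x2 b u < x6 b u"
    using br_strict_mono[of u b "x3 b u" u] x3 u b by (simp add: x2_def x6_def)
  show "- 1 < x2 b u" using u b x3 br_le[of u b "x3 b u"] by (simp add: x2_def)
qed

lemma x1_gt: "u < x1 b u"
  using br_strict_mono[of u b "x2 b u" 0] x2 x6 u b by (simp add: x1_def)

lemma DERIV_x1: "(x1 b has_real_derivative x1 b u * e1 b u / u) (at u)"
proof -
  have "(x4 b has_real_derivative x4 b u * (1 - b * (x5 b u / (1 - x5 b u)) * e5 b u) / u) (at u)"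
    unfolding x4_def[abs_def] using DERIV_br[OF u(1) x5_less DERIV_x5, of b] .
  from DERIV_br[OF u(1) x4(3) this, of b]
  have D3: "(x3 b has_real_derivative x3 b u * e3 b u / u) (at u)"
    unfolding x3_def[abs_def] e3_def .
  have "x3 b u < 1" using x3 u by simp
  from DERIV_neg_br[OF DERIV_br[OF u(1) this D3, of b]]
  have D2: "(x2 b has_real_derivative
    x2 b u * (1 - b * (x3 b u / (1 - x3 b u)) * e3 b u) / u) (at u)"
    unfolding x2_def .
  have "x2 b u < 1" using x2 x6 by simp
  from DERIV_br[OF u(1) this D2, of b] show ?thesis
    unfolding x1_def[abs_def] e1_def .
qed

section \<open>Gap estimates and positivity of \<open>e1\<close>\<close>

text \<open>The rescaled map sends \<open>[x5, x1]\<close> to \<open>[x2, x6]\<close>, then to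
  \<open>[x3, u]\<close>, then to \<open>[0, x4]\<close>. This and the next two estimates bound each
  length below through its image.\<close>

lemma x7_minus_x3: "b * u * x4 b u \<le> u - x3 b u"
  using br_tangent[of u b 0 "x4 b u"] u b x4 by (simp add: x3_def)

lemma x6_minus_x2: "b * (- x2 b u) * (u - x3 b u) / (1 - x3 b u) \<le> x6 b u - x2 b u"
  using br_tangent[of u b "x3 b u" u] u b x3 by (simp add: x2_def x6_def)

lemma x1_minus_x5: "b * x1 b u * (x6 b u - x2 b u) / (1 - x2 b u) \<le> x1 b u - x5 b u"
  using br_tangent[of u b "x2 b u" "x6 b u"] u b x2 x6 by (simp add: x1_def x5_def)

text \<open>Controls the denominator of \<open>r4\<close> in \<open>e1_pos\<close>. With
  \<open>z = 1 - x4 b u\<close>, either \<open>b \<le> z\<close>, or \<open>1 / 2 \<le> z\<close>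
  and hence \<open>ln b \<le> b - 1 \<le> (1 - b) * ln z\<close>.\<close>

lemma x4_bound: "b * (1 - x4 b u) powr b \<le> 1 - x4 b u"
proof -
  define z where "z = 1 - x4 b u"
  have "br b u u \<le> u - b * u * u"
    using br_tangent[of u b 0 u] u b by simp
  then have z: "1 - u + b * u * u \<le> z" using x4 unfolding z_def by simp
  have "0 < z" "z < 1" using x4 by (auto simp: z_def)
  have "b * z powr b \<le> z"
  proof (cases "b \<le> 1 / 2")
    case True
    \<comment> \<open>The product equals \<open>1 - u + b * u * u - b\<close>.\<close>
    have "0 \<le> (1 - u) * (1 - b * (1 + u))"
    proof -
      have "b * (1 + u) \<le> 1 / 2 * 2" by (rule mult_mono) (use True b u in auto)
      then show ?thesis using u by simp
    qed
    then have "b \<le> z" using z by (simp add: algebra_simps)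
    moreover have "z powr b \<le> 1" using \<open>0 < z\<close> \<open>z < 1\<close> b by (simp add: powr_le1)
    ultimately show ?thesis using b by (smt (verit) mult_left_le)
  next
    case False
    have "1 / 2 * (u * u) \<le> b * (u * u)" by (rule mult_right_mono) (use False u in auto)
    \<comment> \<open>The square is twice \<open>1 - u + u * u / 2 - 1 / 2\<close>.\<close>
    moreover have "0 \<le> (1 - u) * (1 - u)" by simp
    ultimately have "1 / 2 \<le> z" using z by (simp add: algebra_simps)
    have "ln (1 / z) \<le> 1 / z - 1" using \<open>0 < z\<close> by (intro ln_le_minus_one) simp
    also have "\<dots> \<le> 1" using \<open>1 / 2 \<le> z\<close> by (simp add: field_simps)
    finally have "- ln z \<le> 1" using \<open>0 < z\<close> by (simp add: ln_div)
    then have "(1 - b) * (- ln z) \<le> (1 - b) * 1" using b by (intro mult_left_mono) auto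
    moreover have "ln b \<le> b - 1" using b by (intro ln_le_minus_one) simp
    ultimately have "ln b + b * ln z \<le> ln z" by (simp add: algebra_simps)
    then have "exp (ln b + b * ln z) \<le> exp (ln z)" by simp
    then show ?thesis using b \<open>0 < z\<close> by (simp add: exp_add powr_def)
  qed
  then show ?thesis by (simp add: z_def)
qed

text \<open>Comparison with \<open>e5\<close>: its coefficient is at most 1 in size, and replacing
  it by 1 leaves \<open>b * (r2 - r6) + b^2 * (r6 * r7 - r2 * r3)\<close> plus a positive
  term.\<close>

lemma e1_pos:
  assumes one: "x1 b u = 1"
  shows "0 < e1 b u"
proof -
  define r2 r3 r4 r5 r6 r7 where r: "r2 = - x2 b u / (1 - x2 b u)" "r3 = x3 b u / (1 - x3 b u)"
    "r4 = x4 b u / (1 - x4 b u)" "r5 = x5 b u / (1 - x5 b u)"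
    "r6 = - x6 b u / (1 - x6 b u)" "r7 = u / (1 - u)"
  have pos: "0 < r2" "0 < r3" "0 < r4" "0 < r5" "0 < r6" "0 < r7"
    using x2 x3 x4 x5_gt x5_less x6 u unfolding r
    by (auto intro!: divide_pos_pos divide_neg_pos)
  have "r6 < r2"
    using x2 x6 unfolding r by (simp add: field_simps)
  \<comment> \<open>Pairing the denominators crosswise makes both quotients monotone, because
    \<open>- x2 b u / (1 - x3 b u)\<close> is \<open>u * (1 - x3 b u) powr (b - 1)\<close>.\<close>
  have X_le: "r2 * r3 \<le> r6 * r7"
  proof -
    have "(1 - x3 b u) powr (b - 1) \<le> (1 - u) powr (b - 1)"
      using b u x3 by (intro powr_mono2') auto
    then have "u * (1 - x3 b u) powr (b - 1) \<le> u * (1 - u) powr (b - 1)"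
      using u by (intro mult_left_mono) auto
    then have A: "- x2 b u / (1 - x3 b u) \<le> - x6 b u / (1 - u)"
      using u x3 by (simp add: x2_def x6_def br_def powr_diff)
    have "x3 b u / (1 - x2 b u) \<le> u / (1 - x6 b u)"
      using x2 x3 x6 u by (intro frac_le) auto
    moreover have "0 \<le> - x6 b u / (1 - u)" "0 \<le> x3 b u / (1 - x2 b u)"
      using x2 x3 x6 u by (auto intro!: divide_nonneg_nonneg divide_nonpos_nonneg)
    ultimately have "(- x2 b u / (1 - x3 b u)) * (x3 b u / (1 - x2 b u))
        \<le> (- x6 b u / (1 - u)) * (u / (1 - x6 b u))"
      using A by (intro mult_mono) auto
    then show ?thesis by (simp add: r ac_simps)
  qed
  have XY_le: "(b^2 * r2 * r3) * (b^2 * r4 * r5) \<le> 1"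
  proof -
    \<comment> \<open>The three gap estimates are chained; \<open>x1 b u = 1\<close> turns the outer
      gap into \<open>1 - x5 b u\<close>, the denominator of \<open>r5\<close>.\<close>
    define d where "d = u - x3 b u"
    have "b * (b * (- x2 b u) * d / (1 - x3 b u)) / (1 - x2 b u)
        \<le> b * (x6 b u - x2 b u) / (1 - x2 b u)"
      using x6_minus_x2 b x2 x6 by (intro divide_right_mono mult_left_mono) (auto simp: d_def)
    also have "\<dots> \<le> 1 - x5 b u" using x1_minus_x5 one by simp
    finally have 1: "b^2 * r2 * d / (1 - x3 b u) \<le> 1 - x5 b u"
      by (simp add: r power2_eq_square ac_simps)
    have 2: "b * u * x4 b u \<le> d" using x7_minus_x3 by (simp add: d_def)
    have "(b^2 * r2 / (1 - x3 b u)) * (b * u * x4 b u) \<le> (b^2 * r2 / (1 - x3 b u)) * d"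
      using 2 b pos x3 u by (intro mult_left_mono) auto
    also have "\<dots> \<le> 1 - x5 b u" using 1 by simp
    finally have 3: "(b^2 * r2 / (1 - x3 b u)) * (b * u * x4 b u) / (1 - x5 b u) \<le> 1"
      by (rule divide_le_eq_1_pos[THEN iffD2, rotated]) (use x5_less in simp)
    have 4: "b * (x3 b u / u) / (1 - x4 b u) * x5 b u \<le> 1"
    proof -
      have "b * (x3 b u / u) / (1 - x4 b u) \<le> 1"
        using x4_bound x4 u by (simp add: x3_def br_def)
      then show ?thesis using x5_less x5_gt u b x3 x4 by (intro mult_le_one) auto
    qed
    have "(b^2 * r2 * r3) * (b^2 * r4 * r5) =
      ((b^2 * r2 / (1 - x3 b u)) * (b * u * x4 b u) / (1 - x5 b u)) *
      (b * (x3 b u / u) / (1 - x4 b u) * x5 b u)"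
      using u by (simp add: r power2_eq_square ac_simps)
    also have "\<dots> \<le> 1"
      using b u x3 x4 x5_gt by (intro mult_le_one[OF 3 _ 4]) auto
    finally show ?thesis .
  qed
  have e5: "e5 b u = 1 + b * r6 - b^2 * r6 * r7"
    by (simp add: e5_def r power2_eq_square right_diff_distrib)
  have "0 < e5 b u" using e5_pos x5_less by simp
  have "e1 b u = 1 + b * r2 - b^2 * r2 * r3 * e3 b u"
    by (simp add: e1_def r power2_eq_square algebra_simps)
  also have "e3 b u = 1 - b * r4 + b^2 * r4 * r5 * e5 b u"
    by (simp add: e3_def r power2_eq_square algebra_simps)
  finally have e1: "e1 b u = 1 + b * r2 - b^2 * (r2 * r3) + b^2 * r2 * r3 * (b * r4)
     - (b^2 * r2 * r3) * (b^2 * r4 * r5) * e5 b u"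
    by (simp add: algebra_simps)
  have "(b^2 * r2 * r3) * (b^2 * r4 * r5) * e5 b u \<le> e5 b u"
    using XY_le \<open>0 < e5 b u\<close> by (simp add: mult_le_cancel_right1)
  moreover have "b^2 * (r2 * r3) \<le> b^2 * (r6 * r7)" using X_le by (intro mult_left_mono) auto
  moreover have "b * r6 < b * r2" using \<open>r6 < r2\<close> b by simp
  moreover have "0 < b^2 * r2 * r3 * (b * r4)" using pos b by simp
  ultimately show ?thesis unfolding e1 using e5 by (simp add: ac_simps)
qed

end

section \<open>Uniqueness of the solution of \<open>x1 b u = 1\<close>\<close>

lemma continuous_on_x5:
  assumes "0 < b" "b < 1" "0 < c" "d < 1"
  shows "continuous_on {c..d} (x5 b)"
  using assms
  by (intro continuous_at_imp_continuous_on ballI DERIV_isCont[OF pullback.DERIV_x5])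
     (simp add: pullback_def)

text \<open>Since \<open>e5\<close> is positive wherever \<open>x5\<close> equals 1, that level is
  crossed only upwards, so the admissible parameters form an initial interval.\<close>

lemma x5_less_one_downward:
  assumes "pullback1 b u" "0 < v" "v \<le> u"
  shows "pullback1 b v"
proof -
  interpret pullback1 b u by fact
  have "x5 b v < 1"
  proof (rule less_level_downward[of v u])
    fix x assume x: "v \<le> x" "x \<le> u" "x5 b x = 1"
    then interpret x: pullback b x
      using assms b u by unfold_locales auto
    show "\<exists>D>0. (x5 b has_real_derivative D) (at x)"
      using x.DERIV_x5 x.e5_pos x(3) x.u by (intro exI[of _ "x5 b x * e5 b x / x"]) auto
  qed (use assms b u x5_less continuous_on_x5 in auto)
  then show ?thesis using assms b u by unfold_locales auto
qed

lemma continuous_on_x1: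
  assumes "pullback1 b u" "0 < c" "d \<le> u"
  shows "continuous_on {c..d} (x1 b)"
  using assms
  by (intro continuous_at_imp_continuous_on ballI DERIV_isCont[OF pullback1.DERIV_x1])
     (auto intro: x5_less_one_downward)

lemma x1_eq_one_DERIV_pos:
  assumes "pullback1 b u" "x1 b u = 1"
  shows "\<exists>D>0. (x1 b has_real_derivative D) (at u)"
proof -
  interpret pullback1 b u by fact
  show ?thesis
    using DERIV_x1 e1_pos assms(2) u by (intro exI[of _ "x1 b u * e1 b u / u"]) auto
qed

text \<open>Just left of \<open>v\<close> the value is below 1, and it stays below 1 down to
  \<open>u\<close> because every crossing is upward.\<close>

lemma x1_eq_one_not_less:
  assumes "0 < u" "u < v" "pullback1 b v" "x1 b u = 1" "x1 b v = 1"
  shows False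
proof -
  obtain D where "D > 0" "(x1 b has_real_derivative D) (at v)"
    using x1_eq_one_DERIV_pos assms by blast
  then obtain d where d: "d > 0" "\<forall>h>0. h < d \<longrightarrow> x1 b (v - h) < x1 b v"
    using DERIV_pos_inc_left by blast
  define h where "h = min (d/2) (v - u)"
  have h: "h > 0" "h < d" "u \<le> v - h" using d assms by (auto simp: h_def)
  have "x1 b u < 1"
  proof (rule less_level_downward[OF h(3)])
    show "continuous_on {u..v - h} (x1 b)"
      using continuous_on_x1 assms h by auto
    show "x1 b (v - h) < 1" using d h assms by auto
    fix x assume "u \<le> x" "x \<le> v - h" "x1 b x = 1"
    then show "\<exists>D>0. (x1 b has_real_derivative D) (at x)"
      using x5_less_one_downward[OF assms(3), of x] h assms
      by (intro x1_eq_one_DERIV_pos) auto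
  qed
  with assms show False by simp
qed

lemma x1_eq_one_unique:
  assumes "pullback1 b u" "pullback1 b v" "x1 b u = 1" "x1 b v = 1"
  shows "u = v"
  using assms x1_eq_one_not_less[of u v b] x1_eq_one_not_less[of v u b]
  by (meson linorder_neqE_linordered_idom pullback1_def pullback_def)

section \<open>Existence of a solution\<close>

lemma less_mult_powr_near_zero:
  fixes b K :: real
  assumes "b < 1" "0 < K"
  obtains x where "0 < x" "x \<le> 1 / 4" "x < K * x powr b"
proof
  \<comment> \<open>The positive solution of \<open>x = K * x powr b\<close>.\<close>
  define e where "e = K powr (1 / (1 - b))"
  define x where "x = min (e / 2) (1 / 4)"
  have "0 < e" using assms by (simp add: e_def)
  then show "0 < x" "x \<le> 1 / 4" by (auto simp: x_def)
  have "x < e" using \<open>0 < e\<close> by (auto simp: x_def min_def)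
  then have "x powr (1 - b) < e powr (1 - b)"
    using \<open>0 < x\<close> assms by (intro powr_less_mono2) auto
  also have "\<dots> = K" using assms by (simp add: e_def powr_powr)
  finally show "x < K * x powr b" using \<open>0 < x\<close> by (simp add: powr_diff field_simps)
qed

text \<open>Close to \<open>u = 1\<close> the excess \<open>x5 b u - u\<close> is at least of order
  \<open>(1 - u) powr b\<close>, which beats \<open>1 - u\<close>.\<close>

lemma x5_gt_one_exists:
  assumes "0 < b" "b < 1"
  obtains u where "1 / 2 < u" "u < 1" "1 < x5 b u"
proof -
  \<comment> \<open>The factor \<open>b / 8\<close> collects \<open>b\<close>, the lower bounds
    \<open>1 / 2\<close> for \<open>u\<close> and \<open>x5 b u\<close>, and the upper bound 2 for
    \<open>1 - x6 b u\<close>.\<close>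
  obtain w where w: "0 < w" "w \<le> 1 / 4" "w < b / 8 * w powr b"
    using less_mult_powr_near_zero[of b "b / 8"] assms by auto
  define u where "u = 1 - w"
  interpret pullback b u using assms w by unfold_locales (auto simp: u_def)
  have "b * (1 / 2) * (1 / 2 * w powr b) / 2 \<le> b * x5 b u * (- x6 b u) / (1 - x6 b u)"
  proof (intro frac_le mult_mono)
    show "1 / 2 * w powr b \<le> - x6 b u"
      using w by (auto simp: x6_def br_def u_def intro!: mult_right_mono)
    show "1 / 2 \<le> x5 b u" using x5_gt w by (simp add: u_def)
  qed (use x6 b x5_gt u in \<open>auto simp: mult_nonneg_nonpos\<close>)
  also have "\<dots> \<le> x5 b u - u"
    using br_tangent[of u b "x6 b u" 0] u b x6 by (simp add: x5_def)
  finally have "1 < x5 b u" using w by (simp add: u_def)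
  moreover have "1 / 2 < u" "u < 1" using w by (auto simp: u_def)
  ultimately show ?thesis using that by blast
qed

text \<open>When \<open>x\<^sub>5\<close> is slightly below 1, the gap \<open>x\<^sub>1 - x\<^sub>5\<close> has order \<open>(1 - x\<^sub>5)\<^bsup>b\<^esup>\<close>, so it exceeds
  \<open>1 - x\<^sub>5\<close>.\<close>

lemma x1_gt_one_exists:
  assumes b: "0 < b" "b < 1"
  obtains u where "1 / 2 \<le> u" "pullback1 b u" "1 < x1 b u"
proof -
  obtain c where c: "1 / 2 < c" "c < 1" "1 < x5 b c"
    using x5_gt_one_exists b by blast
  \<comment> \<open>A lower bound for \<open>- x6 b u\<close> on all of \<open>[1 / 2, c]\<close>,
    fixed before \<open>h\<close> and \<open>u\<close> are chosen.\<close>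
  define m where "m = 1 / 2 * (1 - c) powr b"
  have "m > 0" using c by (simp add: m_def)
  \<comment> \<open>The constant is the product of the factors lost in the three gap
    estimates.\<close>
  then obtain h where h: "0 < h" "h \<le> 1 / 4" "h < b ^ 3 * m / 16 * h powr b"
    using less_mult_powr_near_zero[of b "b ^ 3 * m / 16"] b by auto
  \<comment> \<open>Together with \<open>h \<le> 1 / 4\<close> this lets the intermediate value
    theorem reach the level \<open>1 - h\<close>.\<close>
  have "x5 b (1 / 2) \<le> 3 / 4"
  proof -
    interpret pullback b "1 / 2" using b by unfold_locales auto
    have "- x6 b (1 / 2) \<le> 1 / 2" using br_le[of "1 / 2" b "1 / 2"] b by (simp add: x6_def)
    then have "(1 - x6 b (1 / 2)) powr b \<le> (3 / 2) powr b"
      using b x6 by (intro powr_mono2) auto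
    also have "\<dots> \<le> (3 / 2) powr 1" using b by (intro powr_mono) auto
    finally show ?thesis by (simp add: x5_def br_def)
  qed
  then obtain u where u_bounds: "1 / 2 \<le> u" "u \<le> c" and x5: "x5 b u = 1 - h"
    using IVT'[of "x5 b" "1 / 2" "1 - h" c] continuous_on_x5[of b "1 / 2" c] c h b by auto
  interpret pullback1 b u
    using b u_bounds x5 c h by unfold_locales auto
  have x4: "1 / 2 * h powr b \<le> x4 b u"
    unfolding x4_def br_def x5 using u_bounds h by (intro mult_mono) auto
  have "m \<le> - x6 b u"
    unfolding m_def x6_def br_def minus_minus
    using u_bounds c b by (intro mult_mono powr_mono2) auto
  have "b * (1 / 2) * (1 / 2 * h powr b) \<le> b * u * x4 b u"
    using u_bounds x4 b by (intro mult_mono) auto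
  also have "\<dots> \<le> u - x3 b u" by (rule x7_minus_x3)
  finally have 3: "b * (1 / 2) * (1 / 2 * h powr b) \<le> u - x3 b u" .
  have "b * m * (b * (1 / 2) * (1 / 2 * h powr b)) / 1 \<le> b * (- x2 b u) * (u - x3 b u) / (1 - x3 b u)"
    using 3 \<open>m \<le> - x6 b u\<close> \<open>m > 0\<close> b x2 x3 u
    by (intro frac_le mult_mono) (auto simp: mult_nonneg_nonpos mult_nonpos_nonneg)
  also have "\<dots> \<le> x6 b u - x2 b u" by (rule x6_minus_x2)
  finally have 2: "b * m * (b * (1 / 2) * (1 / 2 * h powr b)) \<le> x6 b u - x2 b u" by simp
  have "b * (1 / 2) * (b * m * (b * (1 / 2) * (1 / 2 * h powr b))) / 2
      \<le> b * x1 b u * (x6 b u - x2 b u) / (1 - x2 b u)"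
    using 2 u_bounds x1_gt \<open>m > 0\<close> b x2 x6 by (intro frac_le mult_mono) auto
  also have "\<dots> \<le> x1 b u - x5 b u" by (rule x1_minus_x5)
  finally have "b ^ 3 * m / 16 * h powr b \<le> x1 b u - x5 b u"
    by (simp add: power3_eq_cube ac_simps)
  then have "1 < x1 b u" using x5 h by simp
  with that u_bounds(1) pullback1_axioms show ?thesis by blast
qed

lemma x1_eq_one_exists:
  assumes b: "0 < b" "b < 1"
  obtains u where "pullback1 b u" "x1 b u = 1"
proof -
  obtain c where c: "1 / 2 \<le> c" "pullback1 b c" "1 < x1 b c"
    using x1_gt_one_exists b by blast
  \<comment> \<open>At the left endpoint, \<open>x2\<close> above -1 gives \<open>x1\<close> at most
    \<open>1 / 2 * 2 powr b\<close>.\<close>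
  have "x1 b (1 / 2) \<le> 1"
  proof -
    interpret pullback1 b "1 / 2" using x5_less_one_downward[of b c "1 / 2"] c by simp
    have "(1 - x2 b (1 / 2)) powr b \<le> 2 powr b"
      using b x2 x6 by (intro powr_mono2) auto
    also have "\<dots> \<le> 2 powr 1" using b by (intro powr_mono) auto
    finally show ?thesis by (simp add: x1_def br_def)
  qed
  then obtain u where "1 / 2 \<le> u" "u \<le> c" "x1 b u = 1"
    using IVT'[of "x1 b" "1 / 2" 1 c] continuous_on_x1[of b c "1 / 2" c] c by auto
  with that x5_less_one_downward[of b c u] c show ?thesis by auto
qed

section \<open>From kneading sequences to backward orbits\<close>

text \<open>Solving for the modulus gives \<open>(a * (1 - x)) powr (1 / alpha)\<close>; factoring
  out \<open>a\<close> leaves the scale \<open>a powr (1 / alpha - 1)\<close>, the parameter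
  \<open>u\<close>.\<close>

lemma powf_eq_iff:
  assumes "alpha > 1" "a > 0"
  shows "powf alpha a s = a * x \<longleftrightarrow>
    x \<le> 1 \<and> \<bar>s\<bar> = a * br (1 / alpha) (a powr (1 / alpha - 1)) x"
proof -
  have br: "a * br (1 / alpha) (a powr (1 / alpha - 1)) x = (a * (1 - x)) powr (1 / alpha)"
    if "x \<le> 1"
    using that assms by (simp add: br_def powr_diff powr_mult)
  have "powf alpha a s = a * x \<longleftrightarrow> \<bar>s\<bar> powr alpha = a * (1 - x)"
    by (auto simp: powf_def algebra_simps)
  also have "\<dots> \<longleftrightarrow> x \<le> 1 \<and> \<bar>s\<bar> = (a * (1 - x)) powr (1 / alpha)"
  proof safe
    assume eq: "\<bar>s\<bar> powr alpha = a * (1 - x)"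
    then have "0 \<le> a * (1 - x)" by (metis powr_ge_zero)
    then show "x \<le> 1" using assms by (simp add: zero_le_mult_iff)
    show "\<bar>s\<bar> = (a * (1 - x)) powr (1 / alpha)"
      unfolding eq[symmetric] using assms by (simp add: powr_powr)
  next
    assume "x \<le> 1" "\<bar>s\<bar> = (a * (1 - x)) powr (1 / alpha)"
    then show "\<bar>s\<bar> powr alpha = a * (1 - x)" using assms by (simp add: powr_powr)
  qed
  finally show ?thesis using br by auto
qed

lemma kn_sym_simps:
  "kn_sym x = R \<longleftrightarrow> 0 < x" "kn_sym x = L \<longleftrightarrow> x < 0" "kn_sym x = C \<longleftrightarrow> x = 0"
  by (auto simp: kn_sym_def)

lemma has_kneading_RLRRRLRC_iff:
  "has_kneading f [R, L, R, R, R, L, R, C] \<longleftrightarrow>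
    0 < f 0 \<and> f (f 0) < 0 \<and> 0 < f (f (f 0)) \<and> 0 < f (f (f (f 0))) \<and>
    0 < f (f (f (f (f 0)))) \<and> f (f (f (f (f (f 0))))) < 0 \<and>
    0 < f (f (f (f (f (f (f 0)))))) \<and> f (f (f (f (f (f (f (f 0))))))) = 0"
  by (simp add: has_kneading_def All_less_Suc2 kn_sym_simps eval_nat_numeral)

text \<open>From the eighth iterate 0 backwards, each sign selects one inverse branch. The first
  iterate is \<open>a\<close>, which closes the orbit as \<open>x1 = 1\<close>.\<close>

lemma has_kneading_powf_iff:
  assumes "alpha > 1" "a > 0"
  shows "has_kneading (powf alpha a) [R, L, R, R, R, L, R, C] \<longleftrightarrow>
    pullback1 (1 / alpha) (a powr (1 / alpha - 1)) \<and> x1 (1 / alpha) (a powr (1 / alpha - 1)) = 1"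
    (is "?lhs \<longleftrightarrow> ?rhs")
proof -
  define b u where "b = 1 / alpha" and "u = a powr (1 / alpha - 1)"
  have b: "0 < b" "b < 1" and u: "0 < u" using assms by (auto simp: b_def u_def)
  let ?f = "powf alpha a"
  have f_iff: "?f s = a * x \<longleftrightarrow> x \<le> 1 \<and> \<bar>s\<bar> = a * br b u x" for s x
    using powf_eq_iff[OF assms] by (simp add: b_def u_def)
  have f0: "?f 0 = a" by (simp add: powf_def)
  have pos: "s = a * br b u x" "x \<le> 1" if "0 < s" "?f s = a * x" for s x
    using that f_iff by auto
  have neg: "s = a * - br b u x" "x \<le> 1" if "s < 0" "?f s = a * x" for s x
    using that f_iff by auto
  \<comment> \<open>Here \<open>x = 1\<close> would force \<open>s = 0\<close>; the nonzero sixth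
    and fourth iterates thus give \<open>u < 1\<close> and \<open>x5 b u < 1\<close>.\<close>
  have less1: "x < 1" if "?f s = a * x" "s \<noteq> 0" for s x
    using that f_iff[of s x] by (cases "x = 1") (auto simp: br_def)
  have "?rhs" if ?lhs
  proof -
    define y where "y n = (?f ^^ n) 0" for n
    have sgn: "y 2 < 0" "0 < y 3" "0 < y 4" "0 < y 5" "y 6 < 0" "0 < y 7" and "y 8 = 0"
      using that unfolding y_def has_kneading_RLRRRLRC_iff by (simp_all add: eval_nat_numeral)
    have y: "y 1 = a" "?f (y 1) = y 2" "?f (y 2) = y 3" "?f (y 3) = y 4" "?f (y 4) = y 5"
      "?f (y 5) = y 6" "?f (y 6) = y 7" "?f (y 7) = y 8"
      by (simp_all add: y_def eval_nat_numeral f0)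
    have y7: "y 7 = a * u" using pos(1)[of "y 7" 0] sgn y \<open>y 8 = 0\<close> by simp
    have y6: "y 6 = a * x6 b u" using neg(1)[of "y 6" u] sgn y y7 by (simp add: x6_def)
    have y5: "y 5 = a * x5 b u" using pos(1)[of "y 5" "x6 b u"] sgn y y6 by (simp add: x5_def)
    have y4: "y 4 = a * x4 b u" using pos(1)[of "y 4" "x5 b u"] sgn y y5 by (simp add: x4_def)
    have y3: "y 3 = a * x3 b u" using pos(1)[of "y 3" "x4 b u"] sgn y y4 by (simp add: x3_def)
    have y2: "y 2 = a * x2 b u" using neg(1)[of "y 2" "x3 b u"] sgn y y3 by (simp add: x2_def)
    have "a = a * x1 b u" using pos(1)[of "y 1" "x2 b u"] assms y y2 by (simp add: x1_def)
    then have "x1 b u = 1" using assms by simp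
    moreover have "u < 1" using less1[of "y 6" u] y y7 sgn by simp
    moreover have "x5 b u < 1" using less1[of "y 4" "x5 b u"] y y5 sgn by simp
    ultimately have "pullback1 b u \<and> x1 b u = 1"
      using b u by (simp add: pullback1_def pullback_def pullback1_axioms_def)
    then show ?thesis by (simp only: b_def u_def)
  qed
  moreover have ?lhs if ?rhs
  proof -
    have one: "x1 b u = 1" and "pullback1 b u" using that by (auto simp: b_def u_def)
    interpret pullback1 b u by fact
    have "?f a = a * x2 b u"
      using f_iff[of a "x2 b u"] assms one x2 x6 by (simp add: x1_def)
    moreover have "?f (a * x2 b u) = a * x3 b u"
      using f_iff assms x3 u by (auto simp: x2_def abs_mult br_nonneg)
    moreover have "?f (a * x3 b u) = a * x4 b u"
      using f_iff assms x4 u by (auto simp: x3_def abs_mult br_nonneg)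
    moreover have "?f (a * x4 b u) = a * x5 b u"
      using f_iff assms x5_less u by (auto simp: x4_def abs_mult br_nonneg)
    moreover have "?f (a * x5 b u) = a * x6 b u"
      using f_iff assms x6 u by (auto simp: x5_def abs_mult br_nonneg)
    moreover have "?f (a * x6 b u) = a * u"
      using f_iff assms u by (auto simp: x6_def abs_mult br_nonneg)
    moreover have "?f (a * u) = 0"
      using f_iff[of "a * u" 0] assms u by simp
    ultimately show ?thesis
      unfolding has_kneading_RLRRRLRC_iff f0 using assms x2 x3 x4 x5_gt x6 u
      by (simp add: mult_pos_neg)
  qed
  ultimately show ?thesis by blast
qed

theorem theorem4p1:
  fixes alpha :: real
  assumes "alpha > 1"
  shows "\<exists>!a::real. has_kneading (powf alpha a) [R, L, R, R, R, L, R, C]"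
proof -
  define b where "b = 1 / alpha"
  have b: "0 < b" "b < 1" using assms by (auto simp: b_def)
  obtain u where u: "pullback1 b u" "x1 b u = 1"
    using x1_eq_one_exists b by blast
  then have "0 < u" by (simp add: pullback1_def pullback_def)
  have iff: "has_kneading (powf alpha a) [R, L, R, R, R, L, R, C] \<longleftrightarrow>
      0 < a \<and> a powr (b - 1) = u" for a
  proof (cases "0 < a")
    case True
    then show ?thesis
      using has_kneading_powf_iff[OF assms True] x1_eq_one_unique u by (auto simp: b_def)
  next
    case False
    then show ?thesis by (simp add: has_kneading_RLRRRLRC_iff powf_def)
  qed
  \<comment> \<open>As \<open>b\<close> differs from 1, the power is invertible on positive reals,
    so uniqueness passes from \<open>u\<close> to \<open>a\<close>.\<close>
  have "a powr (b - 1) = u \<longleftrightarrow> a = u powr (1 / (b - 1))" if "0 < a" for a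
    using that b \<open>0 < u\<close> by (auto simp: powr_powr)
  then show ?thesis
    unfolding iff using \<open>0 < u\<close> by (intro ex1I[of _ "u powr (1 / (b - 1))"]) auto
qed

end
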